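(* Let $T$ be a random field on $\mathbb S^2$ for which there exist $p>0$, $\varepsilon\in(0,1]$ and a constant $C$ such that $$\mathbb E\bigl(|T(x)-T(y)|^p\bigr)\le C\,d(x,y)^{2+\varepsilon p}$$ for all $x,y\in\mathbb S^2$. Then there exists a continuous modification of $T$ that is locally Hölder continuous with exponent $\gamma$ for all $\gamma\in(0,\varepsilon)$.
   Context: $\mathbb S^2$ is the unit sphere in $\mathbb R^3$ with geodesic metric $d(x,y)=\arccos\langle x,y\rangle_{\mathbb R^3}$, and $(\Omega,\mathcal A,\mathbb P)$ is a probability space. A (real-valued) random field on $\mathbb S^2$ is an $\mathcal A\otimes\mathcal B(\mathbb S^2)$-measurable mapping $T:\Omega\times\mathbb S^2\to\mathbb R$ (no Gaussianity or isotropy is assumed). A modification of $T$ is a random field $\tilde T$ with $\mathbb P(\tilde T(x)=T(x))=1$ for every $x\in\mathbb S^2$; continuity and Hölder continuity refer to its sample paths, with respect to $d$. *)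

theory Defs
  imports "HOL-Probability.Probability"
begin

text \<open>
  The unit sphere as a type of its own, so that \<^const>\<open>dist\<close> can be the geodesic metric
  and \<^const>\<open>continuous_on\<close>, \<^const>\<open>ball\<close> and \<^const>\<open>borel\<close> all refer to it. The class
  instance below contains the proof that the geodesic distance is a metric.
\<close>

typedef S2 = "sphere 0 1 :: (real^3) set"
  by (rule exI[of _ "axis 1 1"]) simp

lemma inner_Rep_S2_self: "Rep_S2 x \<bullet> Rep_S2 x = 1"
  using Rep_S2[of x] by (simp add: norm_eq_1)

lemma inner_Rep_S2_bounded: "\<bar>Rep_S2 x \<bullet> Rep_S2 y\<bar> \<le> 1"
  using Cauchy_Schwarz_ineq2[of "Rep_S2 x" "Rep_S2 y"] Rep_S2[of x] Rep_S2[of y] by simp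

lemma arccos_inner_triangle:
  "arccos (Rep_S2 x \<bullet> Rep_S2 z) \<le>
     arccos (Rep_S2 x \<bullet> Rep_S2 y) + arccos (Rep_S2 y \<bullet> Rep_S2 z)"
proof -
  define a where "a = Rep_S2 x \<bullet> Rep_S2 y"
  define b where "b = Rep_S2 y \<bullet> Rep_S2 z"
  define c where "c = Rep_S2 x \<bullet> Rep_S2 z"
  have ab: "\<bar>a\<bar> \<le> 1" "\<bar>b\<bar> \<le> 1" "\<bar>c\<bar> \<le> 1"
    by (simp_all add: a_def b_def c_def inner_Rep_S2_bounded)
  have "arccos c \<le> arccos a + arccos b"
  proof (cases "arccos a + arccos b \<le> pi")
    case False
    moreover have "arccos c \<le> pi"
      using ab by (intro arccos_ubound) auto
    ultimately show ?thesis by linarith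
  next
    case True
    define u where "u = Rep_S2 x - a *\<^sub>R Rep_S2 y"
    define v where "v = Rep_S2 z - b *\<^sub>R Rep_S2 y"
    have uv: "u \<bullet> v = c - a * b" and uu: "u \<bullet> u = 1 - a\<^sup>2" and vv: "v \<bullet> v = 1 - b\<^sup>2"
      by (simp_all add: u_def v_def a_def b_def c_def inner_Rep_S2_self inner_diff_left
            inner_diff_right inner_commute power2_eq_square)
    have "cos (arccos a + arccos b) = a * b - norm u * norm v"
      using ab by (simp add: cos_add sin_arccos_abs cos_arccos_abs norm_eq_sqrt_inner uu vv)
    also have "\<dots> \<le> c"
      using Cauchy_Schwarz_ineq2[of u v] uv by linarith
    finally have "arccos c \<le> arccos (cos (arccos a + arccos b))"
      using ab by (intro arccos_le_arccos) auto
    also have "\<dots> = arccos a + arccos b"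
      using True ab by (intro arccos_cos add_nonneg_nonneg arccos_lbound) auto
    finally show ?thesis .
  qed
  then show ?thesis by (simp add: a_def b_def c_def)
qed

instantiation S2 :: metric_space
begin

definition dist_S2 :: "S2 \<Rightarrow> S2 \<Rightarrow> real"
  where "dist x y = arccos (Rep_S2 x \<bullet> Rep_S2 y)"

definition uniformity_S2 :: "(S2 \<times> S2) filter"
  where "uniformity_S2 = (INF e\<in>{0 <..}. principal {(x, y). dist x y < e})"

definition open_S2 :: "S2 set \<Rightarrow> bool"
  where "open_S2 U \<longleftrightarrow> (\<forall>x\<in>U. eventually (\<lambda>(x', y). x' = x \<longrightarrow> y \<in> U) uniformity)"

instance
proof
  fix x y z :: S2
  show "dist x y = 0 \<longleftrightarrow> x = y"
  proof -
    have "dist x y = 0 \<longleftrightarrow> Rep_S2 x \<bullet> Rep_S2 y = 1"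
      using inner_Rep_S2_bounded[of x y] by (simp add: dist_S2_def arccos_eq_0_iff abs_le_iff)
    also have "\<dots> \<longleftrightarrow> Rep_S2 x = Rep_S2 y"
    proof
      assume "Rep_S2 x \<bullet> Rep_S2 y = 1"
      then have "(Rep_S2 x - Rep_S2 y) \<bullet> (Rep_S2 x - Rep_S2 y) = 0"
        by (simp add: inner_diff_left inner_diff_right inner_commute inner_Rep_S2_self)
      then show "Rep_S2 x = Rep_S2 y" by simp
    qed (simp add: inner_Rep_S2_self)
    finally show ?thesis by (simp add: Rep_S2_inject)
  qed
  show "dist x y \<le> dist x z + dist y z"
    using arccos_inner_triangle[of x y z] by (simp add: dist_S2_def inner_commute)
qed (simp_all add: uniformity_S2_def open_S2_def)

end

definition random_field :: "'w measure \<Rightarrow> ('w \<Rightarrow> S2 \<Rightarrow> real) \<Rightarrow> bool"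
  where "random_field M T \<longleftrightarrow> (\<lambda>(\<omega>, x). T \<omega> x) \<in> borel_measurable (M \<Otimes>\<^sub>M borel)"

definition modification_of ::
    "'w measure \<Rightarrow> ('w \<Rightarrow> S2 \<Rightarrow> real) \<Rightarrow> ('w \<Rightarrow> S2 \<Rightarrow> real) \<Rightarrow> bool"
  where "modification_of M T T' \<longleftrightarrow>
    random_field M T' \<and> (\<forall>x. measure M {\<omega> \<in> space M. T' \<omega> x = T \<omega> x} = 1)"

definition locally_Holder_continuous :: "real \<Rightarrow> ('a::metric_space \<Rightarrow> real) \<Rightarrow> bool"
  where "locally_Holder_continuous \<gamma> f \<longleftrightarrow>
    (\<forall>x. \<exists>r>0. \<exists>L. \<forall>y\<in>ball x r. \<forall>z\<in>ball x r. \<bar>f y - f z\<bar> \<le> L * dist y z powr \<gamma>)"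

end

theory Submission
  imports Defs
begin

text \<open>
  The proof is Kolmogorov's chaining argument. Suppose that finite sets \<open>D n\<close> approximate a metric
  space to within \<open>2^(-n)\<close>, that \<open>D n\<close> has \<open>O(2^(d n))\<close> points, and that only boundedly many of
  them lie within \<open>3 \<sqdot> 2^(-n)\<close> of any given point. Then there are only \<open>O(2^(d n))\<close> pairs of
  a point of \<open>D n\<close> and a neighbour in \<open>D n\<close> or \<open>D (n + 1)\<close>, and the moment hypothesis bounds the expected sum of
  \<open>\<bar>T u - T v\<bar> powr p\<close> over these pairs by a constant times
  \<open>2^(d n) \<sqdot> 2^(-n (d + \<epsilon> p)) = 2^(-n \<epsilon> p)\<close>. For \<open>\<gamma> < \<epsilon>\<close> this remains summable after
  multiplication by \<open>2^(n \<gamma> p)\<close>, so almost surely all increments over the pairs of level \<open>n\<close>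
  are at most \<open>L \<sqdot> 2^(-n \<gamma>)\<close> with a random \<open>L\<close> (lemma \<open>AE_chain_bound\<close>).

  On that event the values of \<open>T\<close> along the projections of a point \<open>x\<close> to \<open>D 0, D 1, \<dots>\<close> converge
  geometrically. Two points whose distance is about \<open>2^(-n)\<close> have neighbouring projections in \<open>D n\<close>,
  which makes the limit \<open>\<gamma>\<close>-Hoelder (lemma \<open>extension_Holder\<close>). For fixed \<open>x\<close> the same values converge
  to \<open>T x\<close> almost surely by a second summation of moments, hence the limit is a modification.

  On the sphere \<open>d = 2\<close>. The net at level \<open>n\<close> is a maximal set of points at geodesic distances
  greater than \<open>2^(-n)\<close>. Geodesic and chordal distance agree up to the factor \<open>3\<close>, so disjoint
  Euclidean balls of radius comparable to \<open>2^(-n)\<close> sit around its points. All of them lie in a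
  spherical shell of volume \<open>O(2^(-n))\<close>, which leaves room for \<open>O(4^n)\<close> such balls; those around the
  points near a given one lie in a single ball of comparable radius, which leaves room for boundedly
  many.
\<close>

section \<open>Packing bounds in Euclidean space\<close>

lemma fmeasurable_lborel_ball: "ball a r \<in> fmeasurable lborel" for a :: "'a::euclidean_space"
  by (intro fmeasurableI emeasure_bounded_finite) auto

text \<open>
  Balls of radius \<open>\<delta> / 2\<close> around \<open>\<delta>\<close>-separated points are disjoint, so their volumes add up.
\<close>

lemma card_separated_mult_le_measure:
  fixes S :: "'a::euclidean_space set"
  assumes "finite S" "0 < \<delta>" "pairwise (\<lambda>x y. \<delta> < dist x y) S"
    and sub: "\<And>x. x \<in> S \<Longrightarrow> ball x (\<delta> / 2) \<subseteq> A" and A: "A \<in> fmeasurable lborel"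
  shows "real (card S) * ((\<delta> / 2) ^ DIM('a) * measure lborel (ball (0::'a) 1)) \<le> measure lborel A"
proof -
  have "real (card S) * ((\<delta> / 2) ^ DIM('a) * measure lborel (ball (0::'a) 1))
        = (\<Sum>x\<in>S. measure lborel (ball x (\<delta> / 2)))"
    using \<open>0 < \<delta>\<close> by (simp add: content_ball_conv_unit_ball[of "\<delta>/2"])
  also have "\<dots> = measure lborel (\<Union>x\<in>S. ball x (\<delta> / 2))"
  proof (rule measure_UNION'[symmetric])
    show "pairwise (\<lambda>x y. disjnt (ball x (\<delta> / 2)) (ball y (\<delta> / 2))) S"
      using assms(3)
    proof (rule pairwise_mono)
      fix x y :: 'a assume "\<delta> < dist x y"
      then show "disjnt (ball x (\<delta> / 2)) (ball y (\<delta> / 2))"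
        unfolding disjnt_def by (intro disjoint_ballI) simp
    qed simp
  qed (use assms in \<open>auto simp: fmeasurable_lborel_ball\<close>)
  also have "\<dots> \<le> measure lborel A"
    using sub A assms(1) by (intro measure_mono_fmeasurable) (auto intro!: sets.finite_UN)
  finally show ?thesis .
qed

lemma card_separated_in_cball:
  fixes S :: "'a::euclidean_space set"
  assumes "finite S" "0 < \<delta>" "0 \<le> R" "pairwise (\<lambda>x y. \<delta> < dist x y) S" "S \<subseteq> cball a R"
  shows "real (card S) \<le> (2 * R / \<delta> + 1) ^ DIM('a)"
proof -
  let ?v = "measure lborel (ball (0::'a) 1)"
  have v: "?v > 0" by (rule content_ball_pos) simp
  have "real (card S) * ((\<delta> / 2) ^ DIM('a) * ?v) \<le> measure lborel (ball a (R + \<delta> / 2))"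
  proof (rule card_separated_mult_le_measure)
    fix x assume "x \<in> S"
    then have "dist a x \<le> R" using assms by auto
    then show "ball x (\<delta> / 2) \<subseteq> ball a (R + \<delta> / 2)"
      by (subst subset_eq) (smt (verit) dist_triangle mem_ball)
  qed (use assms in \<open>auto simp: fmeasurable_lborel_ball\<close>)
  also have "\<dots> = (R + \<delta> / 2) ^ DIM('a) * ?v"
    using assms by (intro content_ball_conv_unit_ball) auto
  also have "R + \<delta> / 2 = (2 * R / \<delta> + 1) * (\<delta> / 2)"
    using assms by (simp add: field_simps)
  finally show ?thesis using v \<open>0 < \<delta>\<close>
    by (simp add: power_mult_distrib del: times_divide_eq_right)
qed

text \<open>
  Applying the bound for balls to the unit ball would only give \<open>O(\<delta> powr -3)\<close>. The exponent drops by
  one because the disjoint balls stay within \<open>\<delta> / 2\<close> of the sphere: the shell around it has volume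
  \<open>O(\<delta>)\<close>.
\<close>

lemma card_separated_in_sphere:
  fixes S :: "'a::euclidean_space set"
  assumes dim: "DIM('a) = 3"
    and "finite S" "0 < \<delta>" "\<delta> \<le> 2" "pairwise (\<lambda>x y. \<delta> < dist x y) S" "S \<subseteq> sphere 0 1"
  shows "real (card S) \<le> 24 / \<delta>\<^sup>2 + 2"
proof -
  let ?v = "measure lborel (ball (0::'a) 1)"
  define h where "h = \<delta> / 2"
  have h: "0 < h" "h \<le> 1" using assms by (auto simp: h_def)
  have v: "?v > 0" by (rule content_ball_pos) simp
  have "real (card S) * (h ^ 3 * ?v) \<le> measure lborel (ball (0::'a) (1 + h) - ball 0 (1 - h))"
    unfolding h_def dim[symmetric]
  proof (rule card_separated_mult_le_measure)
    fix x assume "x \<in> S"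
    then have x: "norm x = 1" using assms by auto
    show "ball x (\<delta> / 2) \<subseteq> ball 0 (1 + \<delta> / 2) - ball 0 (1 - \<delta> / 2)"
    proof
      fix y assume "y \<in> ball x (\<delta> / 2)"
      then have "norm (x - y) < \<delta> / 2" by (simp add: dist_norm)
      then show "y \<in> ball 0 (1 + \<delta> / 2) - ball 0 (1 - \<delta> / 2)"
        using x norm_triangle_ineq3[of x y] by (auto simp: abs_le_iff)
    qed
  qed (use assms in \<open>auto intro!: fmeasurable_Diff fmeasurable_lborel_ball\<close>)
  also have "\<dots> = measure lborel (ball (0::'a) (1 + h)) - measure lborel (ball (0::'a) (1 - h))"
    using h by (intro measurable_measure_Diff fmeasurable_lborel_ball) auto
  also have "\<dots> = ((1 + h) ^ 3 - (1 - h) ^ 3) * ?v"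
    using h by (subst (1 2) content_ball_conv_unit_ball) (auto simp: dim algebra_simps)
  finally have "real (card S) * h ^ 3 \<le> (1 + h) ^ 3 - (1 - h) ^ 3"
    using v by (simp add: mult.assoc[symmetric])
  also have "\<dots> = (6 / h\<^sup>2 + 2) * h ^ 3"
    using h by (simp add: field_simps power2_eq_square power3_eq_cube)
  finally have "real (card S) \<le> 6 / h\<^sup>2 + 2" using h by simp
  then show ?thesis by (simp add: h_def power2_eq_square)
qed

section \<open>Nets in metric spaces\<close>

text \<open>
  A separated set of largest cardinality is a net, since a point far from all its members could be
  added to it.
\<close>

lemma ex_maximal_separated:
  fixes B :: nat
  assumes "0 \<le> \<delta>"
    and "\<And>S :: 'a::metric_space set. finite S \<Longrightarrow> pairwise (\<lambda>x y. \<delta> < dist x y) S \<Longrightarrow> card S \<le> B"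
  obtains D :: "'a::metric_space set" where "finite D" "pairwise (\<lambda>x y. \<delta> < dist x y) D"
    "\<And>x. \<exists>u\<in>D. dist x u \<le> \<delta>"
proof -
  define P where "P S \<longleftrightarrow> finite S \<and> pairwise (\<lambda>x y. \<delta> < dist x y) S" for S :: "'a set"
  have "\<exists>D. P D \<and> (\<forall>S. P S \<longrightarrow> card S \<le> card D)"
    using assms by (intro ex_has_greatest_nat[of P "{}" card "Suc B"]) (auto simp: P_def less_Suc_eq_le)
  then obtain D where D: "P D" and max: "\<And>S. P S \<Longrightarrow> card S \<le> card D" by blast
  have "\<exists>u\<in>D. dist x u \<le> \<delta>" for x
  proof (rule ccontr)
    assume far: "\<not> (\<exists>u\<in>D. dist x u \<le> \<delta>)"
    then have "x \<notin> D" using \<open>0 \<le> \<delta>\<close> by force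
    moreover have "P (insert x D)"
      using D far by (auto simp: P_def pairwise_insert dist_commute not_le)
    ultimately show False using max[of "insert x D"] D by (simp add: P_def)
  qed
  with D that show thesis by (auto simp: P_def)
qed

text \<open>
  A point may have several admissible net points. Enumerating the net and taking the first one
  makes the choice Borel measurable.
\<close>

lemma measurable_net_projection:
  fixes D :: "'a::metric_space set"
  assumes "finite D" "\<And>x. \<exists>u\<in>D. dist x u \<le> \<delta>"
  obtains \<pi> where "\<pi> \<in> borel \<rightarrow>\<^sub>M count_space D" "\<And>x. dist x (\<pi> x) \<le> \<delta>"
proof -
  define e where "e = from_nat_into D"
  define i where "i x = (LEAST k. dist x (e k) \<le> \<delta>)" for x
  have "D \<noteq> {}" using assms(2) by blast
  then have e: "e k \<in> D" for k by (simp add: e_def from_nat_into)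
  have i: "dist x (e (i x)) \<le> \<delta>" for x
  proof -
    obtain u where "u \<in> D" "dist x u \<le> \<delta>" using assms(2) by blast
    then have "dist x (e (to_nat_on D u)) \<le> \<delta>"
      using assms(1) by (simp add: e_def countable_finite)
    then show ?thesis unfolding i_def by (rule LeastI)
  qed
  have dist_meas: "(\<lambda>x. dist x (e k)) \<in> borel_measurable borel" for k
    by (intro borel_measurable_continuous_onI continuous_intros)
  have "Measurable.pred borel (\<lambda>x. dist x (e k) \<le> \<delta>)" for k
    using borel_measurable_le[OF dist_meas borel_measurable_const] by (simp add: pred_def)
  then have "i \<in> borel \<rightarrow>\<^sub>M count_space UNIV"
    unfolding i_def by (rule measurable_Least)
  moreover have "e \<in> count_space UNIV \<rightarrow>\<^sub>M count_space D" using e by simp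
  ultimately have "(\<lambda>x. e (i x)) \<in> borel \<rightarrow>\<^sub>M count_space D" by (rule measurable_compose)
  with i that show thesis by blast
qed

section \<open>Geodesic nets on the sphere\<close>

text \<open>
  A crude form of Jordan's inequality for comparing chords with arcs; half an arc is at most
  \<open>pi / 2 < 2\<close>.
\<close>

lemma sin_ge_third:
  fixes t :: real assumes "0 \<le> t" "t \<le> 2" shows "t / 3 \<le> sin t"
proof -
  have "\<bar>sin t - (\<Sum>m<3. sin_coeff m * t ^ m)\<bar> \<le> inverse (fact 3) * \<bar>t\<bar> ^ 3"
    by (rule Maclaurin_sin_bound)
  then have "\<bar>sin t - t\<bar> \<le> t ^ 3 / 6"
    using assms by (simp add: eval_nat_numeral sin_coeff_def field_simps)
  moreover have "t ^ 3 \<le> 4 * t"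
    using assms mult_mono[of t 2 t 2] mult_right_mono[of "t * t" 4 t] by (simp add: power3_eq_cube)
  ultimately show ?thesis by linarith
qed

lemma dist_Rep_S2:
  "dist (Rep_S2 x) (Rep_S2 y) = 2 * sin (dist x y / 2)"
proof -
  let ?t = "dist x y"
  have t: "0 \<le> ?t" "?t \<le> pi" "cos ?t = Rep_S2 x \<bullet> Rep_S2 y"
    using inner_Rep_S2_bounded[of x y]
    by (auto simp: dist_S2_def abs_le_iff intro!: arccos_ubound cos_arccos arccos_lbound)
  have "(dist (Rep_S2 x) (Rep_S2 y))\<^sup>2 = 2 - 2 * cos ?t"
    by (simp add: t dist_norm power2_norm_eq_inner inner_diff_left inner_diff_right
        inner_commute inner_Rep_S2_self)
  also have "\<dots> = (2 * sin (?t / 2))\<^sup>2"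
    using cos_double_sin[of "?t / 2"] by (simp add: power_mult_distrib)
  finally show ?thesis
    by (rule power2_eq_imp_eq) (use t pi_ge_zero in \<open>auto intro!: sin_ge_zero simp del: pi_ge_zero\<close>)
qed

lemma dist_Rep_S2_le: "dist (Rep_S2 x) (Rep_S2 y) \<le> dist x y"
  using sin_x_le_x[of "dist x y / 2"] by (simp add: dist_Rep_S2)

lemma dist_Rep_S2_ge: "dist x y / 3 \<le> dist (Rep_S2 x) (Rep_S2 y)"
proof -
  have "dist x y \<le> pi"
    using inner_Rep_S2_bounded[of x y] by (auto simp: dist_S2_def abs_le_iff intro!: arccos_ubound)
  then show ?thesis
    using sin_ge_third[of "dist x y / 2"] pi_less_4 by (simp add: dist_Rep_S2)
qed

lemma pairwise_Rep_S2:
  assumes "pairwise (\<lambda>x y. \<delta> < dist x y) S"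
  shows "pairwise (\<lambda>x y. \<delta> / 3 < dist x y) (Rep_S2 ` S)"
  unfolding pairwise_image
proof (rule pairwise_mono[OF assms])
  fix x y :: S2 assume "\<delta> < dist x y"
  then show "Rep_S2 x \<noteq> Rep_S2 y \<longrightarrow> \<delta> / 3 < dist (Rep_S2 x) (Rep_S2 y)"
    using dist_Rep_S2_ge[of x y] by auto
qed simp

lemma card_image_Rep_S2: "card (Rep_S2 ` S) = card S"
  by (intro card_image inj_onI) (simp add: Rep_S2_inject)

lemma card_separated_S2:
  assumes "finite S" "0 < \<delta>" "\<delta> \<le> 1" "pairwise (\<lambda>x y. \<delta> < dist x y) (S :: S2 set)"
  shows "real (card S) \<le> 218 / \<delta>\<^sup>2"
proof -
  have "real (card (Rep_S2 ` S)) \<le> 24 / (\<delta> / 3)\<^sup>2 + 2"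
    using assms Rep_S2 by (intro card_separated_in_sphere pairwise_Rep_S2) auto
  also have "\<dots> = 216 / \<delta>\<^sup>2 + 2" by (simp add: power2_eq_square)
  \<comment> \<open>the additive \<open>2\<close> is absorbed because \<open>\<delta> \<le> 1\<close>\<close>
  also have "\<dots> \<le> 218 / \<delta>\<^sup>2"
    using assms power_le_one[of \<delta> 2] by (simp add: pos_le_divide_eq distrib_right)
  finally show ?thesis by (simp add: card_image_Rep_S2)
qed

text \<open>
  In the chordal metric the points in question are at distance at most \<open>3 \<delta>\<close> from \<open>x\<close> and more than
  \<open>\<delta> / 3\<close> from each other, and \<open>19 = 2 \<sqdot> (3 \<delta>) / (\<delta> / 3) + 1\<close> is the base in the packing bound for balls.
\<close>

lemma card_separated_near_S2:
  fixes x :: S2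
  assumes "finite S" "0 < \<delta>" "pairwise (\<lambda>x y. \<delta> < dist x y) S"
  shows "card {v \<in> S. dist x v \<le> 3 * \<delta>} \<le> 19 ^ 3"
proof -
  let ?N = "{v \<in> S. dist x v \<le> 3 * \<delta>}"
  have "real (card (Rep_S2 ` ?N)) \<le> (2 * (3 * \<delta>) / (\<delta> / 3) + 1) ^ DIM(real ^ 3)"
  proof (rule card_separated_in_cball)
    show "pairwise (\<lambda>x y. \<delta> / 3 < dist x y) (Rep_S2 ` ?N)"
      using assms(3) by (intro pairwise_Rep_S2) (auto elim: pairwise_subset)
    show "Rep_S2 ` ?N \<subseteq> cball (Rep_S2 x) (3 * \<delta>)"
      using dist_Rep_S2_le order_trans by fastforce
  qed (use assms in auto)
  also have "\<dots> = real (19 ^ 3)" using assms by simp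
  finally show ?thesis unfolding card_image_Rep_S2 of_nat_le_iff .
qed

lemma ex_S2_net:
  assumes "0 < \<delta>" "\<delta> \<le> 1"
  obtains D :: "S2 set" where "finite D" "real (card D) \<le> 218 / \<delta>\<^sup>2"
    "\<And>x. card {v \<in> D. dist x v \<le> 3 * \<delta>} \<le> 19 ^ 3" "\<And>x. \<exists>u\<in>D. dist x u \<le> \<delta>"
proof -
  obtain D :: "S2 set" where "finite D" "pairwise (\<lambda>x y. \<delta> < dist x y) D" "\<And>x. \<exists>u\<in>D. dist x u \<le> \<delta>"
  proof (rule ex_maximal_separated)
    show "0 \<le> \<delta>" using assms by simp
    show "card S \<le> nat \<lfloor>218 / \<delta>\<^sup>2\<rfloor>"
      if "finite S" "pairwise (\<lambda>x y. \<delta> < dist x y) S" for S :: "S2 set"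
      using card_separated_S2[OF that(1) assms that(2)] by (simp add: le_nat_floor)
  qed blast
  then show thesis
    using card_separated_S2 card_separated_near_S2 assms that by meson
qed

section \<open>Chaining along a sequence of nets\<close>

lemma powr_dyadic:
  fixes c q :: real
  assumes "0 \<le> c"
  shows "(c / 2 ^ n) powr q = c powr q * (2 powr - q) ^ n"
proof -
  have "(2 ^ n) powr q = (2 powr q) ^ n" by (induction n) (simp_all add: powr_mult)
  then show ?thesis using assms by (simp add: powr_divide powr_minus field_simps)
qed

lemma ex_dyadic_scale:
  fixes t :: real
  assumes "0 < t" "t \<le> 1"
  obtains n where "1 / 2 ^ Suc n < t" "t \<le> 1 / 2 ^ n"
proof -
  define m where "m = (LEAST k. (1 / 2) ^ k < t)"
  obtain k where "(1 / 2) ^ k < t" using real_arch_pow_inv[of t "1/2"] assms by auto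
  then have m: "(1 / 2) ^ m < t" unfolding m_def by (rule LeastI)
  then have "m \<noteq> 0" using assms by (intro notI) simp
  then obtain n where n: "m = Suc n" by (cases m) auto
  have "\<not> (1 / 2) ^ n < t" using not_less_Least[of n "\<lambda>k. (1 / 2) ^ k < t"] n by (simp add: m_def)
  then show thesis using m that[of n] by (simp add: n power_divide)
qed

locale chaining_net =
  fixes D :: "nat \<Rightarrow> 'a::metric_space set" and proj :: "nat \<Rightarrow> 'a \<Rightarrow> 'a"
  assumes proj_in: "proj n x \<in> D n"
    and dist_proj: "dist x (proj n x) \<le> 1 / 2 ^ n"
begin

text \<open>
  The radius \<open>3 / 2 ^ n\<close> leaves room for both kinds of steps taken below: between the projections of
  one point to consecutive levels, and between the projections to level \<open>n\<close> of two points at distance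
  at most \<open>1 / 2 ^ n\<close>.
\<close>

definition near :: "nat \<Rightarrow> 'a \<Rightarrow> 'a set" where
  "near n x = {v \<in> D n. dist x v \<le> 3 / 2 ^ n}"

text \<open>
  The increments that have to be controlled. Both kinds of steps start in \<open>D n\<close>, so those
  within level \<open>n\<close> and those to the next level form one set per level.
\<close>

definition links :: "nat \<Rightarrow> ('a \<times> 'a) set" where
  "links n = (SIGMA u:D n. near n u \<union> near (Suc n) u)"

definition chain_bound :: "real \<Rightarrow> ('a \<Rightarrow> real) \<Rightarrow> bool" where
  "chain_bound \<gamma> f \<longleftrightarrow>
     (\<exists>L. \<forall>n u v. (u, v) \<in> links n \<longrightarrow> \<bar>f u - f v\<bar> \<le> L * (2 powr - \<gamma>) ^ n)"

definition extension :: "('a \<Rightarrow> real) \<Rightarrow> 'a \<Rightarrow> real" where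
  "extension f x = lim (\<lambda>n. f (proj n x))"

lemma proj_Suc_in_links: "(proj n x, proj (Suc n) x) \<in> links n"
proof -
  have "dist (proj n x) (proj (Suc n) x) \<le> 1 / 2 ^ n + 1 / 2 ^ Suc n"
    using dist_triangle3[of "proj n x" "proj (Suc n) x" x] dist_proj[of x n] dist_proj[of x "Suc n"]
    by linarith
  also have "\<dots> = 3 / 2 ^ Suc n" by (simp add: field_simps)
  finally show ?thesis by (simp add: links_def near_def proj_in)
qed

lemma proj_proj_in_links:
  assumes "dist x y \<le> 1 / 2 ^ n"
  shows "(proj n x, proj n y) \<in> links n"
proof -
  have "dist (proj n x) (proj n y) \<le> 1 / 2 ^ n + (1 / 2 ^ n + 1 / 2 ^ n)"
    using dist_triangle3[of "proj n x" "proj n y" x] dist_triangle[of x "proj n y" y]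
      dist_proj[of x n] dist_proj[of y n] assms by linarith
  then show ?thesis by (simp add: links_def near_def proj_in)
qed

text \<open>
  Consecutive approximations of \<open>x\<close> form a link, so their values differ by at most \<open>L * r ^ n\<close>;
  the tail of the geometric series bounds the error at level \<open>n\<close>.
\<close>

lemma chain_converges:
  assumes step: "\<And>n u v. (u, v) \<in> links n \<Longrightarrow> \<bar>f u - f v\<bar> \<le> L * r ^ n"
    and r: "0 < r" "r < 1"
  shows "(\<lambda>n. f (proj n x)) \<longlonglongrightarrow> extension f x"
    and "\<bar>extension f x - f (proj n x)\<bar> \<le> L * r ^ n / (1 - r)"
proof -
  define a where "a n = f (proj n x)" for n
  have a: "\<bar>a (Suc n) - a n\<bar> \<le> L * r ^ n" for n
    using step[OF proj_Suc_in_links, of n x] by (simp add: a_def abs_minus_commute)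
  have "summable (\<lambda>n. a (Suc n) - a n)"
    by (rule summable_comparison_test'[of "\<lambda>n. L * r ^ n" 0])
       (use a r in \<open>auto intro!: summable_mult summable_geometric\<close>)
  then have "convergent (\<lambda>n. (a n - a 0) + a 0)"
    unfolding summable_iff_convergent sum_lessThan_telescope
    by (intro convergent_add convergent_const)
  then have lim: "a \<longlonglongrightarrow> lim a" by (simp add: convergent_LIMSEQ_iff)
  then show conv: "(\<lambda>n. f (proj n x)) \<longlonglongrightarrow> extension f x"
    by (simp add: a_def[abs_def] extension_def)
  have "0 \<le> L" using a[of 0] by simp
  have "\<bar>a (m + n) - a n\<bar> \<le> L * r ^ n / (1 - r)" for m
  proof -
    have "\<bar>a (m + n) - a n\<bar> = \<bar>\<Sum>k<m. a (Suc k + n) - a (k + n)\<bar>"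
      using sum_lessThan_telescope[of "\<lambda>k. a (k + n)" m] by simp
    also have "\<dots> \<le> (\<Sum>k<m. L * r ^ (k + n))"
      using a by (intro order_trans[OF sum_abs] sum_mono) simp
    also have "\<dots> = L * r ^ n * (\<Sum>k<m. r ^ k)"
      by (simp add: sum_distrib_left power_add mult_ac)
    also have "\<dots> \<le> L * r ^ n * (1 / (1 - r))"
      using r \<open>0 \<le> L\<close> by (intro mult_left_mono) (auto simp: sum_gp_strict divide_simps)
    finally show ?thesis by simp
  qed
  moreover have "(\<lambda>m. \<bar>a (m + n) - a n\<bar>) \<longlonglongrightarrow> \<bar>extension f x - a n\<bar>"
    using LIMSEQ_ignore_initial_segment[OF conv, of n]
    by (intro tendsto_intros) (simp add: a_def)
  ultimately have "\<bar>extension f x - a n\<bar> \<le> L * r ^ n / (1 - r)"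
    by (intro LIMSEQ_le_const2) auto
  then show "\<bar>extension f x - f (proj n x)\<bar> \<le> L * r ^ n / (1 - r)" by (simp add: a_def)
qed

text \<open>
  Points at distance between \<open>1 / 2 ^ Suc n\<close> and \<open>1 / 2 ^ n\<close> are compared through their projections to
  level \<open>n\<close>: one link between the projections, and one geometric tail for each of the points.
\<close>

lemma extension_Holder:
  assumes "chain_bound \<gamma> f" "0 < \<gamma>"
  shows "\<exists>L. \<forall>x y. dist x y \<le> 1 \<longrightarrow> \<bar>extension f x - extension f y\<bar> \<le> L * dist x y powr \<gamma>"
proof -
  define r :: real where "r = 2 powr - \<gamma>"
  obtain L where L: "\<And>n u v. (u, v) \<in> links n \<Longrightarrow> \<bar>f u - f v\<bar> \<le> L * r ^ n"
    using assms(1) by (auto simp: chain_bound_def r_def)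
  have r: "0 < r" "r < 1" using assms(2) by (auto simp: r_def powr_less_one)
  define L' where "L' = (2 * L / (1 - r) + L) / r"
  have "\<bar>extension f x - extension f y\<bar> \<le> L' * dist x y powr \<gamma>" if "dist x y \<le> 1" for x y
  proof (cases "x = y")
    case False
    then have "0 < dist x y" by simp
    from ex_dyadic_scale[OF this that]
    obtain n where n: "1 / 2 ^ Suc n < dist x y" "dist x y \<le> 1 / 2 ^ n" .
    \<comment> \<open>a link exists at level \<open>0\<close>, where the bound reads \<open>\<bar>f u - f v\<bar> \<le> L\<close>\<close>
    have "0 \<le> L" using L[OF proj_Suc_in_links[of 0 x]] by simp
    then have L': "0 \<le> L'" using r by (simp add: L'_def)
    have "\<bar>extension f x - extension f y\<bar> \<le> 2 * (L * r ^ n / (1 - r)) + L * r ^ n"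
      using chain_converges(2)[of f, OF L r, where x = x and n = n]
        chain_converges(2)[of f, OF L r, where x = y and n = n]
        L[OF proj_proj_in_links[OF n(2)]] by linarith
    also have "\<dots> = L' * r ^ Suc n" using r by (simp add: L'_def field_simps)
    also have "r ^ Suc n = (1 / 2 ^ Suc n) powr \<gamma>"
      by (subst powr_dyadic) (auto simp: r_def)
    also have "\<dots> \<le> dist x y powr \<gamma>" using n assms(2) by (intro powr_mono2) auto
    finally show ?thesis using L' by (simp add: mult_left_mono)
  qed simp
  then show ?thesis by blast
qed

end

section \<open>The Kolmogorov-Chentsov theorem\<close>

text \<open>
  By monotone convergence the sum has finite expectation, hence is finite almost everywhere.
\<close>

lemma AE_summable:
  fixes f :: "nat \<Rightarrow> 'w \<Rightarrow> real"
  assumes int: "\<And>n. integrable M (f n)" and nonneg: "\<And>n \<omega>. 0 \<le> f n \<omega>"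
    and sum: "summable (\<lambda>n. integral\<^sup>L M (f n))"
  shows "AE \<omega> in M. summable (\<lambda>n. f n \<omega>)"
proof -
  have [measurable]: "f n \<in> borel_measurable M" for n by (rule borel_measurable_integrable[OF int])
  have "(\<integral>\<^sup>+\<omega>. (\<Sum>n. ennreal (f n \<omega>)) \<partial>M) = (\<Sum>n. ennreal (integral\<^sup>L M (f n)))"
    by (subst nn_integral_suminf) (simp_all add: nn_integral_eq_integral[OF int] nonneg)
  also have "\<dots> \<noteq> top"
    using sum by (rule ennreal_suminf_neq_top) (simp add: nonneg)
  finally have "AE \<omega> in M. (\<Sum>n. ennreal (f n \<omega>)) \<noteq> \<infinity>"
    unfolding infinity_ennreal_def[symmetric] by (rule nn_integral_PInf_AE[rotated]) measurable
  then show ?thesis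
  proof eventually_elim
    case (elim \<omega>)
    then have "(\<Sum>n. ennreal (f n \<omega>)) \<noteq> top" by simp
    with nonneg show ?case by (rule summable_suminf_not_top)
  qed
qed

lemma AE_summable_geometric:
  fixes f :: "nat \<Rightarrow> 'w \<Rightarrow> real"
  assumes int: "\<And>n. integrable M (f n)" and nonneg: "\<And>n \<omega>. 0 \<le> f n \<omega>"
    and bound: "\<And>n. integral\<^sup>L M (f n) \<le> A * s ^ n" and s: "0 \<le> s" "s < 1"
  shows "AE \<omega> in M. summable (\<lambda>n. f n \<omega>)"
proof (rule AE_summable[OF int nonneg])
  show "summable (\<lambda>n. integral\<^sup>L M (f n))"
  proof (rule summable_comparison_test'[of "\<lambda>n. A * s ^ n" 0])
    show "summable (\<lambda>n. A * s ^ n)" using s by (intro summable_mult summable_geometric) simp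
    show "norm (integral\<^sup>L M (f n)) \<le> A * s ^ n" for n
      using bound[of n] Bochner_Integration.integral_nonneg[of M "f n"] nonneg by simp
  qed
qed

text \<open>
  The hypotheses of the Kolmogorov-Chentsov theorem over a space that the nets exhibit as having
  dimension \<open>d\<close>: at scale \<open>2^(-n)\<close> the whole space takes \<open>O(2^(d n))\<close> points and a ball of comparable
  radius takes boundedly many.
\<close>

locale moment_field = chaining_net D proj
  for D :: "nat \<Rightarrow> 'a::metric_space set" and proj +
  fixes M :: "'w measure" and T :: "'w \<Rightarrow> 'a \<Rightarrow> real" and p \<epsilon> C d K :: real and N :: nat
  assumes p: "0 < p" and \<epsilon>: "0 < \<epsilon>" and d: "0 \<le> d"
    and finite_D: "finite (D n)"
    and card_D: "real (card (D n)) \<le> K * (2 powr d) ^ n"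
    and card_near: "card (near n x) \<le> N"
    and integrable_increment: "integrable M (\<lambda>\<omega>. \<bar>T \<omega> x - T \<omega> y\<bar> powr p)"
    and moment: "(\<integral>\<omega>. \<bar>T \<omega> x - T \<omega> y\<bar> powr p \<partial>M) \<le> C * dist x y powr (d + \<epsilon> * p)"
begin

lemma card_links: "real (card (links n)) \<le> 2 * N * K * (2 powr d) ^ n"
proof -
  have "card (near n u \<union> near (Suc n) u) \<le> 2 * N" for u
    using card_Un_le[of "near n u" "near (Suc n) u"] card_near[of n u] card_near[of "Suc n" u]
    by linarith
  moreover have "finite (near m u)" for m u using finite_D by (simp add: near_def)
  ultimately have "card (links n) \<le> card (D n) * (2 * N)"
    unfolding links_def using finite_D sum_bounded_above[of "D n" _ "2 * N"]
    by (subst card_SigmaI) auto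
  then have "real (card (links n)) \<le> real (card (D n)) * (2 * N)"
    by (metis of_nat_le_iff of_nat_mult)
  also have "\<dots> \<le> K * (2 powr d) ^ n * (2 * N)" by (intro mult_right_mono card_D) simp
  finally show ?thesis by (simp add: mult_ac)
qed

text \<open>
  The absolute value on \<open>C\<close> keeps the bound monotone in the distance: on a one-point space the moment
  bound holds with negative \<open>C\<close>.
\<close>

lemma moment_dyadic:
  assumes "dist x y \<le> c / 2 ^ n" "0 \<le> c"
  shows "(\<integral>\<omega>. \<bar>T \<omega> x - T \<omega> y\<bar> powr p \<partial>M)
           \<le> \<bar>C\<bar> * c powr (d + \<epsilon> * p) * (2 powr - (d + \<epsilon> * p)) ^ n"
proof -
  let ?q = "d + \<epsilon> * p"
  have "(\<integral>\<omega>. \<bar>T \<omega> x - T \<omega> y\<bar> powr p \<partial>M) \<le> \<bar>C\<bar> * dist x y powr ?q"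
    by (rule order_trans[OF moment]) (simp add: mult_right_mono)
  also have "\<dots> \<le> \<bar>C\<bar> * (c / 2 ^ n) powr ?q"
    using assms p \<epsilon> d by (intro mult_left_mono powr_mono2) auto
  also have "(c / 2 ^ n) powr ?q = c powr ?q * (2 powr - ?q) ^ n"
    using assms by (intro powr_dyadic)
  finally show ?thesis by (simp add: mult.assoc)
qed

text \<open>
  At level \<open>n\<close> there are \<open>O((2 powr d) ^ n)\<close> links, each contributing a moment of order
  \<open>(2 powr - (d + \<epsilon> p)) ^ n\<close>. Weighting level \<open>n\<close> by \<open>(2 powr (\<gamma> p)) ^ n\<close> leaves the ratio
  \<open>2 powr ((\<gamma> - \<epsilon>) p) < 1\<close>, so the weighted sums over the levels are almost surely bounded. Bounding
  the largest increment by the sum of all increments loses nothing in the exponent.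
\<close>

lemma AE_chain_bound:
  assumes "\<gamma> < \<epsilon>"
  shows "AE \<omega> in M. chain_bound \<gamma> (T \<omega>)"
proof -
  define q where "q = d + \<epsilon> * p"
  define S where "S n \<omega> = (\<Sum>(u, v)\<in>links n. \<bar>T \<omega> u - T \<omega> v\<bar> powr p)" for n \<omega>
  define f where "f n \<omega> = (2 powr (\<gamma> * p)) ^ n * S n \<omega>" for n \<omega>
  define A where "A = 2 * N * K * (\<bar>C\<bar> * 3 powr q)"
  have S_nonneg: "0 \<le> S n \<omega>" for n \<omega> unfolding S_def case_prod_beta by (rule sum_nonneg) simp
  then have f_nonneg: "0 \<le> f n \<omega>" for n \<omega> by (simp add: f_def)
  have S_int: "integrable M (S n)" for n
    unfolding S_def case_prod_beta
    by (intro Bochner_Integration.integrable_sum integrable_increment)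
  then have f_int: "integrable M (f n)" for n by (simp add: f_def[abs_def])
  have fin: "finite (links n)" for n
    using finite_D by (auto simp: links_def near_def)
  have "integral\<^sup>L M (f n) \<le> A * (2 powr ((\<gamma> - \<epsilon>) * p)) ^ n" for n
  proof -
    have "integral\<^sup>L M (S n) = (\<Sum>(u, v)\<in>links n. \<integral>\<omega>. \<bar>T \<omega> u - T \<omega> v\<bar> powr p \<partial>M)"
      unfolding S_def case_prod_beta by (intro Bochner_Integration.integral_sum integrable_increment)
    also have "\<dots> \<le> (\<Sum>(u, v)\<in>links n. \<bar>C\<bar> * 3 powr q * (2 powr - q) ^ n)"
    proof (rule sum_mono, clarify)
      fix u v assume "(u, v) \<in> links n"
      moreover have "3 / 2 ^ Suc n \<le> (3 / 2 ^ n :: real)" by (simp add: field_simps)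
      ultimately have "dist u v \<le> 3 / 2 ^ n" by (auto simp: links_def near_def)
      then show "(\<integral>\<omega>. \<bar>T \<omega> u - T \<omega> v\<bar> powr p \<partial>M) \<le> \<bar>C\<bar> * 3 powr q * (2 powr - q) ^ n"
        unfolding q_def by (rule moment_dyadic) simp
    qed
    also have "\<dots> = real (card (links n)) * (\<bar>C\<bar> * 3 powr q * (2 powr - q) ^ n)" by simp
    also have "\<dots> \<le> 2 * N * K * (2 powr d) ^ n * (\<bar>C\<bar> * 3 powr q * (2 powr - q) ^ n)"
      by (intro mult_right_mono card_links) simp
    also have "\<dots> = A * (2 powr d * 2 powr - q) ^ n"
      by (simp add: A_def power_mult_distrib mult_ac)
    also have "2 powr d * 2 powr - q = 2 powr - (\<epsilon> * p)"
      by (simp add: q_def flip: powr_add)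
    finally have "(2 powr (\<gamma> * p)) ^ n * integral\<^sup>L M (S n) \<le> (2 powr (\<gamma> * p)) ^ n * (A * (2 powr - (\<epsilon> * p)) ^ n)"
      by (intro mult_left_mono) auto
    also have "\<dots> = A * (2 powr (\<gamma> * p) * 2 powr - (\<epsilon> * p)) ^ n"
      by (simp add: power_mult_distrib mult_ac)
    also have "2 powr (\<gamma> * p) * 2 powr - (\<epsilon> * p) = (2 powr ((\<gamma> - \<epsilon>) * p) :: real)"
      by (simp add: algebra_simps flip: powr_add)
    finally show ?thesis by (simp add: f_def[abs_def])
  qed
  moreover have "2 powr ((\<gamma> - \<epsilon>) * p) < 1"
    using assms p by (intro powr_less_one) (auto intro: mult_neg_pos)
  ultimately have "AE \<omega> in M. summable (\<lambda>n. f n \<omega>)"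
    using f_int f_nonneg by (intro AE_summable_geometric) auto
  then show ?thesis
  proof eventually_elim
    case (elim \<omega>)
    define B where "B = (\<Sum>n. f n \<omega>)"
    have "\<bar>T \<omega> u - T \<omega> v\<bar> \<le> B powr (1 / p) * (2 powr - \<gamma>) ^ n" if "(u, v) \<in> links n" for n u v
    proof -
      let ?t = "\<bar>T \<omega> u - T \<omega> v\<bar>"
      have "f n \<omega> \<le> B"
        using sum_le_suminf[OF elim, of "{n}"] f_nonneg by (simp add: B_def)
      moreover have "?t powr p \<le> S n \<omega>"
        unfolding S_def using member_le_sum[OF that, of "\<lambda>(u, v). \<bar>T \<omega> u - T \<omega> v\<bar> powr p"] fin by auto
      then have "(2 powr (\<gamma> * p)) ^ n * ?t powr p \<le> f n \<omega>" by (simp add: f_def)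
      ultimately have "(2 powr (\<gamma> * p)) ^ n * ?t powr p \<le> B" by linarith
      then have "((2 powr (\<gamma> * p)) ^ n * ?t powr p) powr (1 / p) \<le> B powr (1 / p)"
        using p by (intro powr_mono2) auto
      also have "((2 powr (\<gamma> * p)) ^ n * ?t powr p) powr (1 / p) = (2 powr \<gamma>) ^ n * ?t"
      proof -
        have "(2 powr (\<gamma> * p)) ^ n = ((2 powr \<gamma>) ^ n) powr p"
          by (induction n) (simp_all add: powr_mult powr_powr)
        then have "(2 powr (\<gamma> * p)) ^ n * ?t powr p = ((2 powr \<gamma>) ^ n * ?t) powr p"
          by (simp add: powr_mult)
        then show ?thesis using p by (simp add: powr_powr)
      qed
      finally show ?thesis
        by (simp add: powr_minus power_inverse divide_inverse[symmetric] pos_le_divide_eq mult.commute)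
    qed
    then show ?case by (auto simp: chain_bound_def)
  qed
qed

text \<open>
  For a fixed \<open>x\<close> there is one increment per level, and its moment decays geometrically in the level;
  so the \<open>p\<close>-th powers of the errors are almost surely summable, and in particular tend to \<open>0\<close>.
\<close>

lemma AE_proj_tendsto: "AE \<omega> in M. (\<lambda>n. T \<omega> (proj n x)) \<longlonglongrightarrow> T \<omega> x"
proof -
  define q where "q = d + \<epsilon> * p"
  have "q > 0" using p \<epsilon> d by (simp add: q_def add_nonneg_pos)
  then have q: "2 powr - q < 1" by (intro powr_less_one) auto
  have "(\<integral>\<omega>. \<bar>T \<omega> (proj n x) - T \<omega> x\<bar> powr p \<partial>M) \<le> \<bar>C\<bar> * (2 powr - q) ^ n" for n
    using moment_dyadic[of "proj n x" x 1 n] dist_proj[of x n]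
    by (simp add: q_def dist_commute)
  then have "AE \<omega> in M. summable (\<lambda>n. \<bar>T \<omega> (proj n x) - T \<omega> x\<bar> powr p)"
    using q by (intro AE_summable_geometric[OF integrable_increment]) auto
  then show ?thesis
  proof eventually_elim
    case (elim \<omega>)
    from summable_LIMSEQ_zero[OF elim]
    have "(\<lambda>n. (\<bar>T \<omega> (proj n x) - T \<omega> x\<bar> powr p) powr (1 / p)) \<longlonglongrightarrow> 0 powr (1 / p)"
      using p by (intro tendsto_powr') auto
    then have "(\<lambda>n. \<bar>T \<omega> (proj n x) - T \<omega> x\<bar>) \<longlonglongrightarrow> 0"
      using p by (simp add: powr_powr)
    then show ?case
      by (simp add: tendsto_rabs_zero_iff LIM_zero_iff)
  qed
qed

text \<open>
  Almost sure statements for uncountably many exponents are combined through the rational ones: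
  between \<open>\<gamma>\<close> and \<open>\<epsilon>\<close> there is a rational exponent, and at distances at most \<open>1\<close> the Hoelder condition
  with the larger exponent is the stronger one. On the exceptional null set the modification is \<open>0\<close>,
  so that all its paths are Hoelder continuous.
\<close>

theorem Kolmogorov_Chentsov:
  assumes T: "(\<lambda>(\<omega>, x). T \<omega> x) \<in> borel_measurable (M \<Otimes>\<^sub>M borel)"
    and proj: "\<And>n. proj n \<in> borel \<rightarrow>\<^sub>M count_space (D n)"
  obtains T' where "(\<lambda>(\<omega>, x). T' \<omega> x) \<in> borel_measurable (M \<Otimes>\<^sub>M borel)"
    and "\<And>x. AE \<omega> in M. T' \<omega> x = T \<omega> x"
    and "\<And>\<omega> \<gamma>. 0 < \<gamma> \<Longrightarrow> \<gamma> < \<epsilon> \<Longrightarrow>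
           \<exists>L. \<forall>x y. dist x y \<le> 1 \<longrightarrow> \<bar>T' \<omega> x - T' \<omega> y\<bar> \<le> L * dist x y powr \<gamma>"
proof -
  have "AE \<omega> in M. \<forall>\<gamma>\<in>\<rat> \<inter> {0<..<\<epsilon>}. chain_bound \<gamma> (T \<omega>)"
    by (subst AE_ball_countable) (auto intro!: AE_chain_bound countable_Int1 countable_rat)
  then obtain Z where Z: "Z \<in> null_sets M"
    and good: "\<And>\<omega> \<gamma>. \<omega> \<in> space M - Z \<Longrightarrow> \<gamma> \<in> \<rat> \<Longrightarrow> 0 < \<gamma> \<Longrightarrow> \<gamma> < \<epsilon> \<Longrightarrow> chain_bound \<gamma> (T \<omega>)"
    by (auto elim!: AE_E3)
  have [measurable]: "Z \<in> sets M" using Z by auto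
  define T' where "T' \<omega> x = (if \<omega> \<in> space M - Z then extension (T \<omega>) x else 0)" for \<omega> x
  have Tu: "(\<lambda>\<omega>. T \<omega> u) \<in> borel_measurable M" for u
    using measurable_compose[OF measurable_Pair2'[of u borel M] T] by simp
  \<comment> \<open>\<open>proj n\<close> takes finitely many values, so measurability of \<open>T\<close> at single points suffices\<close>
  have "(\<lambda>z. T (fst z) (proj n (snd z))) \<in> borel_measurable (M \<Otimes>\<^sub>M borel)" for n
  proof (rule measurable_compose_countable'[where I = "D n"])
    show "(\<lambda>z. T (fst z) u) \<in> borel_measurable (M \<Otimes>\<^sub>M borel)" for u
      by (rule measurable_compose[OF measurable_fst Tu])
    show "(\<lambda>z. proj n (snd z)) \<in> M \<Otimes>\<^sub>M borel \<rightarrow>\<^sub>M count_space (D n)"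
      by (rule measurable_compose[OF measurable_snd proj])
  qed (simp add: countable_finite finite_D)
  note [measurable] = this
  have "(\<lambda>z. if fst z \<in> space M - Z then lim (\<lambda>n. T (fst z) (proj n (snd z))) else 0)
          \<in> borel_measurable (M \<Otimes>\<^sub>M borel)"
    by measurable
  then have meas: "(\<lambda>(\<omega>, x). T' \<omega> x) \<in> borel_measurable (M \<Otimes>\<^sub>M borel)"
    unfolding T'_def extension_def case_prod_beta' .
  have modif: "AE \<omega> in M. T' \<omega> x = T \<omega> x" for x
    using AE_proj_tendsto[of x] AE_not_in[OF Z] AE_space
    by eventually_elim (auto simp: T'_def extension_def limI)
  have "\<exists>L. \<forall>x y. dist x y \<le> 1 \<longrightarrow> \<bar>T' \<omega> x - T' \<omega> y\<bar> \<le> L * dist x y powr \<gamma>"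
    if \<gamma>: "0 < \<gamma>" "\<gamma> < \<epsilon>" for \<omega> \<gamma>
  proof (cases "\<omega> \<in> space M - Z")
    case True
    obtain \<beta> where \<beta>: "\<beta> \<in> \<rat>" "\<gamma> < \<beta>" "\<beta> < \<epsilon>" using Rats_dense_in_real[OF \<gamma>(2)] by blast
    then obtain L where L: "\<And>x y. dist x y \<le> 1 \<Longrightarrow>
        \<bar>extension (T \<omega>) x - extension (T \<omega>) y\<bar> \<le> L * dist x y powr \<beta>"
      using extension_Holder[OF good[OF True \<beta>(1)]] \<gamma> by auto
    have "\<bar>T' \<omega> x - T' \<omega> y\<bar> \<le> \<bar>L\<bar> * dist x y powr \<gamma>" if "dist x y \<le> 1" for x y
    proof -
      have "\<bar>T' \<omega> x - T' \<omega> y\<bar> \<le> \<bar>L\<bar> * dist x y powr \<beta>"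
        using L[OF that] True mult_right_mono[OF abs_ge_self[of L], of "dist x y powr \<beta>"]
        by (simp add: T'_def)
      also have "\<dots> \<le> \<bar>L\<bar> * dist x y powr \<gamma>"
        using that \<beta> by (intro mult_left_mono powr_mono') auto
      finally show ?thesis .
    qed
    then show ?thesis by blast
  next
    case False
    then show ?thesis unfolding T'_def by (intro exI[of _ 0]) auto
  qed
  with meas modif that show thesis by blast
qed

end

section \<open>Random fields on the sphere\<close>

lemma locally_Holder_continuousI:
  fixes f :: "'a::metric_space \<Rightarrow> real"
  assumes "\<And>x y. dist x y \<le> 1 \<Longrightarrow> \<bar>f x - f y\<bar> \<le> L * dist x y powr \<gamma>"
  shows "locally_Holder_continuous \<gamma> f"
proof -
  have "\<bar>f y - f z\<bar> \<le> L * dist y z powr \<gamma>" if "y \<in> ball x (1 / 2)" "z \<in> ball x (1 / 2)" for x y z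
  proof (rule assms)
    show "dist y z \<le> 1" using dist_triangle3[of y z x] that by simp
  qed
  then show ?thesis
    unfolding locally_Holder_continuous_def by (intro allI exI[of _ "1 / 2 :: real"] conjI exI[of _ L] ballI) auto
qed

lemma locally_Holder_continuous_imp_continuous_on:
  assumes "locally_Holder_continuous \<gamma> f" "0 < \<gamma>"
  shows "continuous_on UNIV f"
proof -
  have "isCont f x" for x
  proof -
    obtain r L where r: "0 < r"
      and L: "\<forall>y\<in>ball x r. \<forall>z\<in>ball x r. \<bar>f y - f z\<bar> \<le> L * dist y z powr \<gamma>"
      using assms(1) unfolding locally_Holder_continuous_def by blast
    have "((\<lambda>y. dist y x) \<longlongrightarrow> 0) (at x)"
      using tendsto_dist_iff[of "\<lambda>y. y" x "at x"] tendsto_ident_at by blast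
    then have "((\<lambda>y. dist y x powr \<gamma>) \<longlongrightarrow> 0) (at x)"
      using tendsto_powr'[of "\<lambda>y. dist y x" 0 "at x" "\<lambda>_. \<gamma>" \<gamma>] assms(2) by simp
    then have lim: "((\<lambda>y. L * dist y x powr \<gamma>) \<longlongrightarrow> 0) (at x)"
      by (rule tendsto_mult_right_zero)
    have "\<forall>\<^sub>F y in at x. y \<in> ball x r"
      using eventually_at_ball[OF r, of x UNIV] by simp
    then have "\<forall>\<^sub>F y in at x. norm (f y - f x) \<le> L * dist y x powr \<gamma>"
      by eventually_elim (use L r in simp)
    then have "((\<lambda>y. f y - f x) \<longlongrightarrow> 0) (at x)"
      using lim by (rule Lim_null_comparison)
    then show "isCont f x" by (simp add: isCont_def LIM_zero_iff)
  qed
  then show ?thesis by (simp add: continuous_at_imp_continuous_on)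
qed

lemma ex_S2_chaining_net:
  obtains D :: "nat \<Rightarrow> S2 set" and proj where "chaining_net D proj"
    "\<And>n. finite (D n)" "\<And>n. real (card (D n)) \<le> 218 * (2 powr 2) ^ n"
    "\<And>n x. card (chaining_net.near D n x) \<le> 19 ^ 3"
    "\<And>n. proj n \<in> borel \<rightarrow>\<^sub>M count_space (D n)"
proof -
  define good where "good n D \<pi> \<longleftrightarrow> finite D \<and> real (card D) \<le> 218 * (2 powr 2) ^ n \<and>
      (\<forall>x. card {v \<in> D. dist x v \<le> 3 / 2 ^ n} \<le> 19 ^ 3) \<and>
      \<pi> \<in> borel \<rightarrow>\<^sub>M count_space D \<and> (\<forall>x. dist x (\<pi> x) \<le> 1 / 2 ^ n)"
    for n :: nat and D :: "S2 set" and \<pi>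
  have "\<exists>D \<pi>. good n D \<pi>" for n
  proof -
    obtain D :: "S2 set" where D: "finite D" "real (card D) \<le> 218 / (1 / 2 ^ n)\<^sup>2"
      "\<And>x. card {v \<in> D. dist x v \<le> 3 * (1 / 2 ^ n)} \<le> 19 ^ 3" "\<And>x. \<exists>u\<in>D. dist x u \<le> 1 / 2 ^ n"
      by (rule ex_S2_net[of "1 / 2 ^ n"]) auto
    obtain \<pi> where "\<pi> \<in> borel \<rightarrow>\<^sub>M count_space D" "\<And>x. dist x (\<pi> x) \<le> 1 / 2 ^ n"
      using measurable_net_projection[OF D(1,4)] by metis
    moreover have "(2 ^ n)\<^sup>2 = (4 :: real) ^ n" by (simp add: power2_eq_square flip: power_mult_distrib)
    ultimately have "good n D \<pi>" using D by (simp add: good_def power_divide)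
    then show ?thesis by blast
  qed
  then obtain D proj where good: "\<And>n. good n (D n) (proj n)" by metis
  have "chaining_net D proj"
  proof
    show "proj n x \<in> D n" for n x
      using good[of n] measurable_space[of "proj n" borel "count_space (D n)" x]
      by (simp add: good_def)
  qed (use good in \<open>simp add: good_def\<close>)
  with good that show thesis by (simp add: good_def chaining_net.near_def)
qed

theorem theorem4p4:
  fixes M :: "'w measure" and T :: "'w \<Rightarrow> S2 \<Rightarrow> real" and p \<epsilon> C :: real
  assumes "prob_space M"
    and "random_field M T"
    and "p > 0"
    and "0 < \<epsilon>" "\<epsilon> \<le> 1"
    and "\<And>x y. integrable M (\<lambda>\<omega>. \<bar>T \<omega> x - T \<omega> y\<bar> powr p)"
    and "\<And>x y. prob_space.expectation M (\<lambda>\<omega>. \<bar>T \<omega> x - T \<omega> y\<bar> powr p)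
                 \<le> C * dist x y powr (2 + \<epsilon> * p)"
  shows "\<exists>T'. modification_of M T T' \<and>
           (\<forall>\<omega>\<in>space M. continuous_on UNIV (T' \<omega>)) \<and>
           (\<forall>\<gamma>. 0 < \<gamma> \<and> \<gamma> < \<epsilon> \<longrightarrow>
              (\<forall>\<omega>\<in>space M. locally_Holder_continuous \<gamma> (T' \<omega>)))"
proof -
  interpret prob_space M by fact
  obtain D :: "nat \<Rightarrow> S2 set" and proj where net: "chaining_net D proj" and D: "\<And>n. finite (D n)"
    "\<And>n. real (card (D n)) \<le> 218 * (2 powr 2) ^ n" "\<And>n x. card (chaining_net.near D n x) \<le> 19 ^ 3"
    and proj: "\<And>n. proj n \<in> borel \<rightarrow>\<^sub>M count_space (D n)"
    using ex_S2_chaining_net by metis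
  interpret chaining_net D proj by (rule net)
  interpret moment_field D proj M T p \<epsilon> C 2 218 "19 ^ 3"
    by unfold_locales (use assms(3-7) D in simp_all)
  obtain T' where T': "(\<lambda>(\<omega>, x). T' \<omega> x) \<in> borel_measurable (M \<Otimes>\<^sub>M borel)"
    and modif: "\<And>x. AE \<omega> in M. T' \<omega> x = T \<omega> x"
    and Holder: "\<And>\<omega> \<gamma>. 0 < \<gamma> \<Longrightarrow> \<gamma> < \<epsilon> \<Longrightarrow>
           \<exists>L. \<forall>x y. dist x y \<le> 1 \<longrightarrow> \<bar>T' \<omega> x - T' \<omega> y\<bar> \<le> L * dist x y powr \<gamma>"
    using Kolmogorov_Chentsov[OF assms(2)[unfolded random_field_def] proj] by blast
  have local_Holder: "locally_Holder_continuous \<gamma> (T' \<omega>)" if "0 < \<gamma>" "\<gamma> < \<epsilon>" for \<gamma> \<omega>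
    using Holder[OF that, of \<omega>] locally_Holder_continuousI by blast
  have "continuous_on UNIV (T' \<omega>)" for \<omega>
    using local_Holder[of "\<epsilon> / 2" \<omega>] \<open>0 < \<epsilon>\<close>
    by (intro locally_Holder_continuous_imp_continuous_on[of "\<epsilon> / 2"]) auto
  moreover have "modification_of M T T'"
    unfolding modification_of_def random_field_def
  proof (intro conjI allI T')
    fix x
    have "(\<lambda>\<omega>. F \<omega> x) \<in> borel_measurable M"
      if "(\<lambda>(\<omega>, x). F \<omega> x) \<in> borel_measurable (M \<Otimes>\<^sub>M borel)" for F :: "'w \<Rightarrow> S2 \<Rightarrow> real"
      using measurable_compose[OF measurable_Pair2'[of x borel M] that] by simp
    note [measurable] = this[OF T'] this[OF assms(2)[unfolded random_field_def]]
    have "{\<omega> \<in> space M. T' \<omega> x = T \<omega> x} \<in> events" by measurable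
    then show "prob {\<omega> \<in> space M. T' \<omega> x = T \<omega> x} = 1"
      using modif[of x] by (simp add: prob_Collect_eq_1)
  qed
  ultimately show ?thesis using local_Holder by blast
qed

end
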